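(* For any sequence $k=k(n)$ of positive integers with $k=o(n)$ and any $\epsilon>0$, there exist $\epsilon$-almost $k$-separable matrices with $m=O(k\log n)$ rows. More precisely, for $\alpha\in[\ln 2,1]$ define \[ M_1(n,k,\alpha)=\frac{1}{-\ln(1-2e^{-\alpha}+2e^{-2\alpha})}\,k\ln\frac nk,\qquad M_2(n,k,\alpha)=\frac{1}{-\ln\!\big(1-2e^{-\alpha}+2e^{-\alpha(1+1/k)}\big)}\,\ln(nk), \] \[ M(n,k)=\min_{\alpha\in[\ln 2,1]}\max\{M_1(n,k,\alpha),M_2(n,k,\alpha)\}. \] Then for any $\epsilon,\delta>0$, for all sufficiently large $n$ and every integer $m>(1+\delta)M(n,k)$, there exists an $m\times n$ binary matrix that is $\epsilon$-almost $k$-separable.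
   Context: For a binary matrix $\mathbf{A}\in\{0,1\}^{m\times n}$, let $S_i\subseteq\{1,\dots,m\}$ denote the support of column $i$ (the set of rows where column $i$ has a $1$), and for $\mathcal{K}\subseteq\{1,\dots,n\}$ let $S(\mathcal{K})=\bigcup_{i\in\mathcal{K}}S_i$. The matrix $\mathbf{A}$ is $\epsilon$-almost $k$-separable if for at most $\epsilon\binom nk$ sets $\mathcal{K}\subseteq\{1,\dots,n\}$ with $|\mathcal{K}|=k$ there exists another set $\mathcal{L}\neq\mathcal{K}$ with $|\mathcal{L}|=k$ and $S(\mathcal{L})=S(\mathcal{K})$. Logarithms $\ln$ are natural. *)

theory Defs
  imports "Jordan_Normal_Form.Matrix" "HOL-Analysis.Analysis" "HOL-Library.Landau_Symbols"
begin

definition binary_mats :: "nat \<Rightarrow> nat \<Rightarrow> nat mat set" where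
  "binary_mats m n = {A \<in> carrier_mat m n. elements_mat A \<subseteq> {0, 1}}"

text \<open>Rows and columns are indexed from \<open>0\<close>, as in the matrix library.\<close>

definition col_supp :: "nat mat \<Rightarrow> nat \<Rightarrow> nat set" where
  "col_supp A i = {r. r < dim_row A \<and> A $$ (r, i) = 1}"

definition union_supp :: "nat mat \<Rightarrow> nat set \<Rightarrow> nat set" where
  "union_supp A K = (\<Union>i\<in>K. col_supp A i)"

definition almost_separable :: "real \<Rightarrow> nat \<Rightarrow> nat mat \<Rightarrow> bool" where
  "almost_separable \<epsilon> k A \<longleftrightarrow>
     real (card {K. K \<subseteq> {..<dim_col A} \<and> card K = k \<and>
       (\<exists>L. L \<subseteq> {..<dim_col A} \<and> card L = k \<and> L \<noteq> K \<and> union_supp A L = union_supp A K)})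
     \<le> \<epsilon> * real (dim_col A choose k)"

definition M1 :: "nat \<Rightarrow> nat \<Rightarrow> real \<Rightarrow> real" where
  "M1 n k \<alpha> = 1 / (- ln (1 - 2 * exp (- \<alpha>) + 2 * exp (- 2 * \<alpha>)))
     * (real k * ln (real n / real k))"

definition M2 :: "nat \<Rightarrow> nat \<Rightarrow> real \<Rightarrow> real" where
  "M2 n k \<alpha> = 1 / (- ln (1 - 2 * exp (- \<alpha>) + 2 * exp (- \<alpha> * (1 + 1 / real k))))
     * ln (real n * real k)"

definition M :: "nat \<Rightarrow> nat \<Rightarrow> real" where
  "M n k = (INF \<alpha>\<in>{ln 2..1}. max (M1 n k \<alpha>) (M2 n k \<alpha>))"

text \<open>The infimum in the definition of \<open>M\<close> is a minimum.\<close>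

lemma ln_arg_bounds:
  fixes \<alpha> t :: real
  assumes "\<alpha> \<in> {ln 2..1}" "t > 0"
  shows "0 < 1 - 2 * exp (- \<alpha>) + 2 * exp (- \<alpha> * (1 + t))"
    and "1 - 2 * exp (- \<alpha>) + 2 * exp (- \<alpha> * (1 + t)) < 1"
proof -
  have "ln 2 > (0::real)" by simp
  with assms(1) have a: "\<alpha> > 0" by (simp only: atLeastAtMost_iff) linarith
  have "exp (- \<alpha>) \<le> exp (- ln 2)" using assms(1) by simp
  also have "exp (- ln 2) = (1/2::real)" by (simp add: exp_minus)
  finally have "2 * exp (- \<alpha>) \<le> 1" by simp
  moreover have "exp (- \<alpha> * (1 + t)) > 0" by simp
  ultimately show "0 < 1 - 2 * exp (- \<alpha>) + 2 * exp (- \<alpha> * (1 + t))" by linarith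
  have "exp (- \<alpha> * (1 + t)) < exp (- \<alpha>)"
    using a assms(2) by (simp add: algebra_simps)
  then show "1 - 2 * exp (- \<alpha>) + 2 * exp (- \<alpha> * (1 + t)) < 1" by simp
qed

lemma M_attained:
  assumes "k \<ge> 1"
  shows "\<exists>\<alpha>\<in>{ln 2..1}. M n k = max (M1 n k \<alpha>) (M2 n k \<alpha>) \<and>
    (\<forall>\<beta>\<in>{ln 2..1}. max (M1 n k \<alpha>) (M2 n k \<alpha>) \<le> max (M1 n k \<beta>) (M2 n k \<beta>))"
proof -
  let ?f = "\<lambda>\<alpha>. max (M1 n k \<alpha>) (M2 n k \<alpha>)"
  have c: "continuous_on {ln 2..1} (\<lambda>\<alpha>::real. 1 / (- ln (1 - 2 * exp (- \<alpha>) + 2 * exp (- \<alpha> * (1 + t)))))"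
    if "t > 0" for t :: real
  proof (intro continuous_intros ballI)
    fix \<alpha> :: real assume "\<alpha> \<in> {ln 2..1}"
    from ln_arg_bounds[OF this that]
    show "1 - 2 * exp (- \<alpha>) + 2 * exp (- \<alpha> * (1 + t)) \<noteq> 0"
      and "- ln (1 - 2 * exp (- \<alpha>) + 2 * exp (- \<alpha> * (1 + t))) \<noteq> 0"
      by auto
  qed
  have "continuous_on {ln 2..1} (M1 n k)"
    unfolding M1_def using c[of 1] by (intro continuous_on_mult continuous_on_const) (simp add: mult.commute)
  moreover have "continuous_on {ln 2..1} (M2 n k)"
    unfolding M2_def using c[of "1 / real k"] assms
    by (intro continuous_on_mult continuous_on_const) simp
  ultimately have cf: "continuous_on {ln 2..1} ?f"
    by (intro continuous_on_max)
  have "ln 2 \<le> (1::real)" using ln_le_minus_one[of "2::real"] by simp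
  then have "{ln 2..1::real} \<noteq> {}" by simp
  from continuous_attains_inf[OF compact_Icc this cf] obtain \<alpha>
    where a: "\<alpha> \<in> {ln 2..1}" "\<forall>\<beta>\<in>{ln 2..1}. ?f \<alpha> \<le> ?f \<beta>" by blast
  have "M n k = ?f \<alpha>"
    unfolding M_def using a by (intro cInf_eq_minimum) auto
  with a show ?thesis by blast
qed

end

theory Submission imports Defs begin

text \<open>Draw every entry independently, equal to 1 with probability \<open>1 - exp (- \<alpha> / k)\<close>. Two
  \<open>k\<close>-sets \<open>K, L\<close> with \<open>card (L - K) = l\<close> agree in a row with probability \<open>f (l / k)\<close>, where
  \<open>f x = 1 - 2 exp (- \<alpha>) + 2 exp (- \<alpha> (1 + x))\<close>, so the expected proportion of confused \<open>k\<close>-sets is at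
  most the sum over \<open>1 \<le> l \<le> k\<close> of \<open>(k choose l) (n choose l) f (l / k) ^ m\<close>.
  Put \<open>\<eta> = \<delta> / (1 + \<delta>)\<close>. For \<open>l \<le> \<eta> k\<close> the function \<open>- ln f\<close> is nearly linear, so that
  \<open>m > (1 + \<delta>) M2\<close>, which controls \<open>l = 1\<close>, bounds the term by \<open>(n powr (- \<delta> / 2)) ^ l\<close>. For \<open>l > \<eta> k\<close>
  the inequality \<open>f x \<le> f 1 powr x\<close> transfers \<open>m > (1 + \<delta>) M1\<close>, which controls \<open>l = k\<close>, and bounds the
  term by \<open>((e / \<eta>)\<^sup>2 (k / n) powr \<delta>) ^ l\<close>. Both geometric series tend to 0.\<close>

section \<open>Averaging over Bernoulli matrices\<close>

text \<open>The weight is the probability that a random subset of \<open>V\<close>, containing each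
  point independently with probability \<open>p\<close>, equals \<open>R\<close>. Avoiding
  \<open>K\<close> costs a factor \<open>1 - p\<close> per point of \<open>K\<close>; the remaining
  points contribute \<open>p + (1 - p)\<close> each.\<close>

lemma sum_Bernoulli_weight_avoiding:
  fixes p :: real
  assumes "finite V" "K \<subseteq> V"
  shows "(\<Sum>R\<in>Pow V. of_bool (R \<inter> K = {}) * (p ^ card R * (1 - p) ^ card (V - R)))
    = (1 - p) ^ card K"
proof -
  have "(\<Sum>R\<in>Pow V. of_bool (R \<inter> K = {}) * (p ^ card R * (1 - p) ^ card (V - R)))
      = (\<Sum>R\<in>Pow (V - K). p ^ card R * (1 - p) ^ card (V - R))"
    using assms by (intro sum.mono_neutral_cong_right) auto
  also have "\<dots> = (\<Sum>R\<in>Pow (V - K). (1 - p) ^ card K * (p ^ card R * (1 - p) ^ card (V - K - R)))"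
  proof (intro sum.cong refl)
    fix R assume R: "R \<in> Pow (V - K)"
    then have "V - R = K \<union> (V - K - R)" "K \<inter> (V - K - R) = {}" using assms by auto
    then have "card (V - R) = card K + card (V - K - R)"
      using card_Un_disjoint[of K "V - K - R"] assms finite_subset by (metis finite_Diff)
    then show "p ^ card R * (1 - p) ^ card (V - R)
        = (1 - p) ^ card K * (p ^ card R * (1 - p) ^ card (V - K - R))"
      by (simp add: power_add)
  qed
  also have "\<dots> = (1 - p) ^ card K * (\<Prod>x\<in>V - K. p + (1 - p))"
    using assms prod_add[of "V - K" "\<lambda>_. p" "\<lambda>_. 1 - p"] by (simp flip: sum_distrib_left)
  finally show ?thesis by simp
qed

text \<open>For truth values a and b, the indicator of a = b is 1 - [a] - [b] + 2 [a and b]. Here a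
  and b say that \<open>R\<close> misses \<open>K\<close> and \<open>L\<close>, and both hold
  exactly when \<open>R\<close> misses \<open>K \<union> L\<close>.\<close>

lemma sum_Bernoulli_weight_agree:
  fixes p :: real
  assumes "finite V" "K \<subseteq> V" "L \<subseteq> V"
  shows "(\<Sum>R\<in>Pow V. of_bool ((R \<inter> K = {}) = (R \<inter> L = {})) * (p ^ card R * (1 - p) ^ card (V - R)))
    = 1 - (1 - p) ^ card K - (1 - p) ^ card L + 2 * (1 - p) ^ card (K \<union> L)"
proof -
  let ?w = "\<lambda>R. p ^ card R * (1 - p) ^ card (V - R)"
  \<comment> \<open>The constant 1 is written as the indicator of avoiding \<open>{}\<close>, so
    that all four sums are instances of the preceding lemma.\<close>
  have "of_bool ((R \<inter> K = {}) = (R \<inter> L = {})) * ?w R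
      = of_bool (R \<inter> {} = {}) * ?w R - of_bool (R \<inter> K = {}) * ?w R
        - of_bool (R \<inter> L = {}) * ?w R + 2 * (of_bool (R \<inter> (K \<union> L) = {}) * ?w R)" for R
    by (auto simp: Int_Un_distrib)
  then have "(\<Sum>R\<in>Pow V. of_bool ((R \<inter> K = {}) = (R \<inter> L = {})) * ?w R)
      = (\<Sum>R\<in>Pow V. of_bool (R \<inter> {} = {}) * ?w R) - (\<Sum>R\<in>Pow V. of_bool (R \<inter> K = {}) * ?w R)
        - (\<Sum>R\<in>Pow V. of_bool (R \<inter> L = {}) * ?w R)
        + 2 * (\<Sum>R\<in>Pow V. of_bool (R \<inter> (K \<union> L) = {}) * ?w R)"
    by (simp only: sum.distrib sum_subtractf sum_distrib_left)
  then show ?thesis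
    using assms sum_Bernoulli_weight_avoiding[of V "{}" p] sum_Bernoulli_weight_avoiding[of V K p]
      sum_Bernoulli_weight_avoiding[of V L p] sum_Bernoulli_weight_avoiding[of V "K \<union> L" p]
    by (simp only:) simp
qed

section \<open>Random matrices with independent rows\<close>

text \<open>Row supports are the natural coordinates here: rows are independent, and whether row
  \<open>i\<close> lies in the union of supports over \<open>K\<close> depends only on whether
  \<open>R i\<close> meets \<open>K\<close>.\<close>

definition mat_of_row_sets :: "nat \<Rightarrow> nat \<Rightarrow> (nat \<Rightarrow> nat set) \<Rightarrow> nat mat" where
  "mat_of_row_sets m n R = Matrix.mat m n (\<lambda>(i, j). of_bool (j \<in> R i))"

lemma mat_of_row_sets_binary: "mat_of_row_sets m n R \<in> binary_mats m n"
  by (auto simp: binary_mats_def mat_of_row_sets_def elements_mat_def)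

lemma union_supp_mat_of_row_sets:
  assumes "K \<subseteq> {..<n}"
  shows "union_supp (mat_of_row_sets m n R) K = {r. r < m \<and> R r \<inter> K \<noteq> {}}"
proof -
  have "col_supp (mat_of_row_sets m n R) j = {r. r < m \<and> j \<in> R r}" if "j \<in> K" for j
  proof -
    have "j < n" using that assms by auto
    then show ?thesis by (auto simp: col_supp_def mat_of_row_sets_def of_bool_def split: if_splits)
  qed
  then show ?thesis by (auto simp: union_supp_def)
qed

text \<open>Independence of the rows: with product weights, the probability that every row satisfies
  \<open>P\<close> is the product of the single-row probabilities.\<close>

lemma sum_of_bool_PiE_power:
  fixes w :: "'b \<Rightarrow> real"
  assumes "finite S" "finite B"
  shows "(\<Sum>g\<in>S \<rightarrow>\<^sub>E B. of_bool (\<forall>i\<in>S. P (g i)) * (\<Prod>i\<in>S. w (g i)))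
    = (\<Sum>y\<in>B. of_bool (P y) * w y) ^ card S"
proof -
  have eq: "of_bool (\<forall>i\<in>S. P (g i)) * (\<Prod>i\<in>S. w (g i)) = (\<Prod>i\<in>S. of_bool (P (g i)) * w (g i))" for g
    using assms(1) by (auto simp: prod.distrib prod_zero_iff)
  show ?thesis
    using prod_sum_PiE[of S "\<lambda>_. B" "\<lambda>_ y. of_bool (P y) * w y"] assms
    by (simp add: eq)
qed

lemma exists_le_weighted_average:
  fixes w f :: "'a \<Rightarrow> real"
  assumes "finite S" "\<And>x. x \<in> S \<Longrightarrow> w x \<ge> 0" "sum w S = 1"
  shows "\<exists>x\<in>S. f x \<le> (\<Sum>y\<in>S. w y * f y)"
proof (rule ccontr)
  define c where "c = (\<Sum>y\<in>S. w y * f y)"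
  assume "\<not> ?thesis"
  then have gt: "f x > c" if "x \<in> S" for x using that by (auto simp: c_def not_le)
  \<comment> \<open>Weights may vanish, so strict inequality of the two averages needs a point of
    nonzero weight; one exists because the weights sum to 1.\<close>
  obtain x where x: "x \<in> S" "w x \<noteq> 0"
    using assms(3) by (metis sum.neutral zero_neq_one)
  have "(\<Sum>y\<in>S. w y * c) < (\<Sum>y\<in>S. w y * f y)"
  proof (rule sum_strict_mono_ex1[OF assms(1)])
    show "\<forall>y\<in>S. w y * c \<le> w y * f y"
      using gt assms(2) by (auto intro: mult_left_mono less_imp_le)
    show "\<exists>y\<in>S. w y * c < w y * f y"
      using x gt[OF x(1)] assms(2)[OF x(1)] by (intro bexI[of _ x]) auto
  qed
  then show False using assms(3) by (simp add: c_def flip: sum_distrib_right)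
qed

section \<open>Union bound over pairs of sets\<close>

text \<open>For fixed \<open>K\<close> the set \<open>L\<close> is recovered from the removed part
  \<open>K - L\<close> and the added part \<open>L - K\<close>. Both have size \<open>l\<close>
  because \<open>K\<close> and \<open>L\<close> have equal size.\<close>

lemma card_sets_at_distance_le:
  assumes "finite V" "K \<subseteq> V" "card K = k"
  shows "card {L. L \<subseteq> V \<and> card L = k \<and> card (L - K) = l} \<le> (k choose l) * (card V choose l)"
proof -
  have fK: "finite K" using assms finite_subset by blast
  let ?S = "{L. L \<subseteq> V \<and> card L = k \<and> card (L - K) = l}"
  let ?T = "{X. X \<subseteq> K \<and> card X = l} \<times> {X. X \<subseteq> V \<and> card X = l}"
  have "card ?S \<le> card ?T"
  proof (rule card_inj_on_le)
    show "inj_on (\<lambda>L. (K - L, L - K)) ?S" by (rule inj_onI) auto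
    show "(\<lambda>L. (K - L, L - K)) ` ?S \<subseteq> ?T"
    proof clarsimp
      fix L assume L: "L \<subseteq> V" "k = card L" "l = card (L - K)"
      then have "finite L" using assms finite_subset by blast
      then have "card (K - L) = card (L - K)"
        using L assms(3) fK by (metis card_Diff_subset_Int finite_Int inf_commute)
      then show "card (K - L) = card (L - K) \<and> L - K \<subseteq> V" using L by auto
    qed
    show "finite ?T" using assms fK by auto
  qed
  also have "card ?T = (k choose l) * (card V choose l)"
    using assms fK by (simp add: card_cartesian_product n_subsets)
  finally show ?thesis .
qed

lemma pos_of_ge_ln2:
  fixes \<alpha> :: real
  assumes "\<alpha> \<in> {ln 2..1}"
  shows "\<alpha> > 0"
proof -
  have "ln 2 > (0::real)" by simp
  with assms show ?thesis by (simp only: atLeastAtMost_iff) linarith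
qed

text \<open>The argument \<open>x\<close> is the relative distance \<open>l / k\<close>. At
  \<open>x = 1\<close> this is the argument of the logarithm in \<open>M1\<close>, at
  \<open>x = 1 / k\<close> that in \<open>M2\<close>.\<close>

definition row_agreement_prob :: "real \<Rightarrow> real \<Rightarrow> real" where
  "row_agreement_prob \<alpha> x = 1 - 2 * exp (- \<alpha>) + 2 * exp (- \<alpha> * (1 + x))"

text \<open>This is an upper bound for the expected proportion of confused sets, not its exact
  value: it comes from a union bound over \<open>L\<close>, with the number of \<open>L\<close> at
  each distance overestimated.\<close>

definition expected_confusion :: "nat \<Rightarrow> nat \<Rightarrow> nat \<Rightarrow> real \<Rightarrow> real" where
  "expected_confusion m n k \<alpha> = (\<Sum>l=1..k. real (k choose l) * real (n choose l)
     * row_agreement_prob \<alpha> (real l / real k) ^ m)"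

lemma exists_mat_few_confused:
  assumes k: "k \<ge> 1" and a: "\<alpha> \<in> {ln 2..1}" and eps: "expected_confusion m n k \<alpha> \<le> \<epsilon>"
  shows "\<exists>A\<in>binary_mats m n. almost_separable \<epsilon> k A"
proof -
  \<comment> \<open>With this choice \<open>(1 - p) ^ j = exp (- \<alpha> * j / k)\<close>, so a row
    misses a given \<open>k\<close>-set with probability \<open>exp (- \<alpha>)\<close>.\<close>
  define p where "p = 1 - exp (- \<alpha> / real k)"
  have "\<alpha> > 0" using a by (rule pos_of_ge_ln2)
  with k have p: "0 \<le> p" "p \<le> 1" by (auto simp: p_def)
  define V where "V = {..<n}"
  define w where "w R = p ^ card R * (1 - p) ^ card (V - R)" for R
  define W where "W g = (\<Prod>i<m. w (g i))" for g
  define G where "G = {..<m} \<rightarrow>\<^sub>E Pow V"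
  define F where "F = {K. K \<subseteq> V \<and> card K = k}"
  define agree where "agree g K L \<longleftrightarrow> (\<forall>i\<in>{..<m}. (g i \<inter> K = {}) = (g i \<inter> L = {}))"
    for g :: "nat \<Rightarrow> nat set" and K L
  \<comment> \<open>Counting ordered confused pairs instead of confused sets makes the count a sum
    of indicators, whose mean is computed pair by pair.\<close>
  define N where "N g = (\<Sum>K\<in>F. \<Sum>L\<in>F - {K}. of_bool (agree g K L) :: real)" for g
  have fin: "finite V" "finite F" "finite G" by (auto simp: V_def F_def G_def intro!: finite_PiE)
  have w0: "w R \<ge> 0" for R using p by (simp add: w_def)
  have "(\<Sum>R\<in>Pow V. w R) = 1"
    using sum_Bernoulli_weight_avoiding[of V "{}" p] fin by (simp add: w_def)
  then have W1: "sum W G = 1"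
    using sum_of_bool_PiE_power[of "{..<m}" "Pow V" "\<lambda>_. True" w] fin by (simp add: G_def W_def)
  obtain g where g: "g \<in> G" "N g \<le> (\<Sum>h\<in>G. W h * N h)"
    using exists_le_weighted_average[OF fin(3) _ W1, of N] w0 by (auto simp: W_def prod_nonneg)
  have pair: "(\<Sum>h\<in>G. W h * of_bool (agree h K L))
      = row_agreement_prob \<alpha> (real (card (L - K)) / real k) ^ m" if "K \<in> F" "L \<in> F" for K L
  proof -
    have KL: "K \<subseteq> V" "L \<subseteq> V" "card K = k" "card L = k" using that by (auto simp: F_def)
    have fKL: "finite K" "finite L" using KL fin finite_subset by blast+
    have "card (K \<union> L) = card K + card (L - K)"
      using card_Un_disjoint[of K "L - K"] fKL by simp
    then have "(\<Sum>R\<in>Pow V. of_bool ((R \<inter> K = {}) = (R \<inter> L = {})) * w R)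
       = 1 - 2 * (1 - p) ^ k + 2 * (1 - p) ^ (k + card (L - K))"
      unfolding w_def using sum_Bernoulli_weight_agree[OF fin(1) KL(1,2), of p] KL by simp
    also have "\<dots> = row_agreement_prob \<alpha> (real (card (L - K)) / real k)"
      using k by (simp add: p_def row_agreement_prob_def field_simps flip: exp_of_nat_mult)
    finally show ?thesis
      using sum_of_bool_PiE_power[of "{..<m}" "Pow V" "\<lambda>R. (R \<inter> K = {}) = (R \<inter> L = {})" w] fin
      by (simp add: G_def W_def agree_def mult.commute)
  qed
  have inner: "(\<Sum>L\<in>F - {K}. row_agreement_prob \<alpha> (real (card (L - K)) / real k) ^ m)
      \<le> expected_confusion m n k \<alpha>" if K: "K \<in> F" for K
  proof -
    have fK: "finite K" using K fin finite_subset by (auto simp: F_def)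
    \<comment> \<open>Distance 0 would give \<open>L \<subseteq> K\<close>, hence
      \<open>L = K\<close> by equal size.\<close>
    have "card (L - K) \<in> {1..k}" if L: "L \<in> F - {K}" for L
    proof -
      have fL: "finite L" using L fin finite_subset by (auto simp: F_def)
      have "L - K \<noteq> {}" using L K fK card_subset_eq[of K L] by (auto simp: F_def)
      then have "card (L - K) \<noteq> 0" using fL by simp
      moreover have "card (L - K) \<le> card L" using fL by (intro card_mono) auto
      ultimately show ?thesis using L by (auto simp: F_def)
    qed
    then have "(\<Sum>L\<in>F - {K}. row_agreement_prob \<alpha> (real (card (L - K)) / real k) ^ m)
      = (\<Sum>l=1..k. \<Sum>L\<in>{L\<in>F - {K}. card (L - K) = l}. row_agreement_prob \<alpha> (real (card (L - K)) / real k) ^ m)"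
      using fin by (intro sum.group[symmetric]) (simp, simp, blast)
    also have "\<dots> \<le> expected_confusion m n k \<alpha>" unfolding expected_confusion_def
    proof (rule sum_mono)
      fix l assume l: "l \<in> {1..k}"
      have pos: "row_agreement_prob \<alpha> (real l / real k) ^ m \<ge> 0"
        using ln_arg_bounds(1)[OF a, of "real l / real k"] l k
        by (auto simp: row_agreement_prob_def intro!: zero_le_power)
      have "(\<Sum>L\<in>{L\<in>F - {K}. card (L - K) = l}. row_agreement_prob \<alpha> (real (card (L - K)) / real k) ^ m)
        = real (card {L\<in>F - {K}. card (L - K) = l}) * row_agreement_prob \<alpha> (real l / real k) ^ m"
        by simp
      also have "card {L\<in>F - {K}. card (L - K) = l} \<le> card {L. L \<subseteq> V \<and> card L = k \<and> card (L - K) = l}"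
        using fin by (intro card_mono) (auto simp: F_def)
      also have "\<dots> \<le> (k choose l) * (n choose l)"
        using card_sets_at_distance_le[OF fin(1), of K k l] K by (simp add: F_def V_def)
      finally show "(\<Sum>L\<in>{L\<in>F - {K}. card (L - K) = l}. row_agreement_prob \<alpha> (real (card (L - K)) / real k) ^ m)
        \<le> real (k choose l) * real (n choose l) * row_agreement_prob \<alpha> (real l / real k) ^ m"
        using pos by (simp add: mult_right_mono flip: of_nat_mult)
    qed
    finally show ?thesis .
  qed
  have "(\<Sum>h\<in>G. W h * N h) = (\<Sum>h\<in>G. \<Sum>K\<in>F. \<Sum>L\<in>F - {K}. W h * of_bool (agree h K L))"
    by (simp add: N_def sum_distrib_left)
  also have "\<dots> = (\<Sum>K\<in>F. \<Sum>h\<in>G. \<Sum>L\<in>F - {K}. W h * of_bool (agree h K L))"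
    by (rule sum.swap)
  also have "\<dots> = (\<Sum>K\<in>F. \<Sum>L\<in>F - {K}. \<Sum>h\<in>G. W h * of_bool (agree h K L))"
    by (intro sum.cong refl sum.swap)
  also have "\<dots> = (\<Sum>K\<in>F. \<Sum>L\<in>F - {K}. row_agreement_prob \<alpha> (real (card (L - K)) / real k) ^ m)"
    by (intro sum.cong refl pair) auto
  also have "\<dots> \<le> (\<Sum>K\<in>F. \<epsilon>)"
    using inner eps by (intro sum_mono) (meson order_trans)
  also have "\<dots> = \<epsilon> * real (n choose k)"
    using n_subsets[OF fin(1), of k] by (simp add: F_def V_def)
  finally have Ng: "N g \<le> \<epsilon> * real (n choose k)" using g(2) by linarith
  define A where "A = mat_of_row_sets m n g"
  have dim: "dim_col A = n" by (simp add: A_def mat_of_row_sets_def)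
  have eqA: "agree g K L" if "K \<in> F" "L \<in> F" "union_supp A L = union_supp A K" for K L
    using that union_supp_mat_of_row_sets[of K n m g] union_supp_mat_of_row_sets[of L n m g]
    by (auto simp: A_def F_def V_def agree_def set_eq_iff)
  let ?bad = "{K. K \<subseteq> {..<n} \<and> card K = k \<and>
       (\<exists>L. L \<subseteq> {..<n} \<and> card L = k \<and> L \<noteq> K \<and> union_supp A L = union_supp A K)}"
  have "real (card ?bad) = (\<Sum>K\<in>F. of_bool (K \<in> ?bad))"
    using fin by (subst sum_of_bool_eq) (auto simp: F_def V_def intro!: arg_cong[of _ _ card])
  \<comment> \<open>A confused \<open>K\<close> has at least one partner \<open>L\<close>, which
    alone contributes 1 to the inner sum.\<close>
  also have "\<dots> \<le> N g" unfolding N_def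
  proof (rule sum_mono)
    fix K assume K: "K \<in> F"
    show "of_bool (K \<in> ?bad) \<le> (\<Sum>L\<in>F - {K}. of_bool (agree g K L) :: real)"
    proof (cases "K \<in> ?bad")
      case True
      then obtain L where L: "L \<in> F - {K}" "union_supp A L = union_supp A K"
        by (auto simp: F_def V_def)
      then have "(1::real) = of_bool (agree g K L)" using eqA K by auto
      also have "\<dots> \<le> (\<Sum>L\<in>F - {K}. of_bool (agree g K L) :: real)"
        using L fin by (intro member_le_sum) auto
      finally show ?thesis using True by simp
    next
      case False
      then have "of_bool (K \<in> ?bad) = (0::real)" by (simp only: of_bool_eq)
      then show ?thesis by (simp only:) (simp add: sum_nonneg)
    qed
  qed
  finally have "almost_separable \<epsilon> k A" using Ng unfolding almost_separable_def dim by linarith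
  then show ?thesis using mat_of_row_sets_binary A_def by blast
qed


section \<open>Estimates for the agreement probability\<close>

lemma row_agreement_prob_eq:
  "row_agreement_prob \<alpha> x = 1 - 2 * exp (- \<alpha>) + 2 * exp (- \<alpha>) * exp (- \<alpha> * x)"
  by (simp add: row_agreement_prob_def algebra_simps flip: exp_add)

lemma two_exp_minus_le_1:
  fixes \<alpha> :: real
  assumes "\<alpha> \<in> {ln 2..1}"
  shows "2 * exp (- \<alpha>) \<le> 1"
proof -
  have "exp (- \<alpha>) \<le> exp (- ln 2)" using assms by simp
  also have "exp (- ln 2) = (1/2::real)" by (simp add: exp_minus)
  finally show ?thesis by simp
qed

lemma row_agreement_prob_bounds:
  assumes "\<alpha> \<in> {ln 2..1}" "x > 0"
  shows "row_agreement_prob \<alpha> x > 0" "row_agreement_prob \<alpha> x < 1"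
  using ln_arg_bounds[OF assms] by (simp_all add: row_agreement_prob_def)

text \<open>Concavity of \<open>t \<mapsto> t powr x\<close>; the restriction \<open>\<alpha> \<ge> ln 2\<close> makes the weights nonnegative.\<close>

lemma row_agreement_prob_le_powr:
  assumes a: "\<alpha> \<in> {ln 2..1}" and x: "0 \<le> x" "x \<le> 1"
  shows "row_agreement_prob \<alpha> x \<le> row_agreement_prob \<alpha> 1 powr x"
proof -
  define b where "b = 2 * exp (- \<alpha>)"
  define F where "F = row_agreement_prob \<alpha> 1"
  have F: "F > 0" using row_agreement_prob_bounds[OF a] by (simp add: F_def)
  have b: "0 \<le> b" "b \<le> 1" using two_exp_minus_le_1[OF a] by (simp_all add: b_def)
  \<comment> \<open>The claim is multiplied by \<open>F powr (1 - x)\<close>, so that weighted AM-GM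
    applies to the pairs \<open>1, F\<close> and \<open>exp (- \<alpha>), F\<close>. Averaging the
    two bounds with weights \<open>1 - b\<close> and \<open>b\<close> gives
    \<open>x * F + (1 - x) * F = F\<close>.\<close>
  have 1: "1 * F powr (1 - x) \<le> x * 1 + (1 - x) * F"
    using Youngs_inequality_0[of x "1 - x" 1 F] x F by simp
  have 2: "exp (- \<alpha> * x) * F powr (1 - x) \<le> x * exp (- \<alpha>) + (1 - x) * F"
    using Youngs_inequality_0[of x "1 - x" "exp (- \<alpha>)" F] x F by (simp add: powr_def mult.commute)
  have "row_agreement_prob \<alpha> x * F powr (1 - x)
      = (1 - b) * (1 * F powr (1 - x)) + b * (exp (- \<alpha> * x) * F powr (1 - x))"
    by (simp add: row_agreement_prob_eq b_def algebra_simps)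
  also have "\<dots> \<le> (1 - b) * (x * 1 + (1 - x) * F) + b * (x * exp (- \<alpha>) + (1 - x) * F)"
    using b by (intro add_mono mult_left_mono 1 2) auto
  also have "\<dots> = x * ((1 - b) + b * exp (- \<alpha>)) + (1 - x) * F" by (simp add: algebra_simps)
  also have "(1 - b) + b * exp (- \<alpha>) = F" by (simp add: F_def b_def row_agreement_prob_eq)
  also have "x * F + (1 - x) * F = F powr x * F powr (1 - x)"
    using F by (simp add: algebra_simps flip: powr_add)
  finally show ?thesis using F by (simp add: F_def)
qed

text \<open>Weighted AM-GM for 1 and \<open>exp (- \<alpha> * x)\<close> with weights
  \<open>1 - b\<close> and \<open>b\<close>, where \<open>b = 2 * exp (- \<alpha>)\<close>. It
  bounds the decay rate \<open>- ln f\<close> above by a linear function, which turns a bound in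
  terms of \<open>M2\<close> into a lower bound on \<open>m\<close>.\<close>

lemma exp_le_row_agreement_prob:
  assumes a: "\<alpha> \<in> {ln 2..1}"
  shows "exp (- (2 * exp (- \<alpha>) * \<alpha> * x)) \<le> row_agreement_prob \<alpha> x"
proof -
  define b where "b = 2 * exp (- \<alpha>)"
  have b: "0 \<le> b" "b \<le> 1" using two_exp_minus_le_1[OF a] by (simp_all add: b_def)
  have "1 powr (1 - b) * exp (- \<alpha> * x) powr b \<le> (1 - b) * 1 + b * exp (- \<alpha> * x)"
    using b by (intro Youngs_inequality_0) auto
  moreover have "exp (- \<alpha> * x) powr b = exp (- (b * \<alpha> * x))"
    by (simp add: powr_def mult_ac)
  ultimately show ?thesis by (simp add: row_agreement_prob_eq b_def mult_ac)
qed

lemma exp_minus_le_quadratic: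
  fixes y :: real
  assumes "y \<ge> 0"
  shows "exp (- y) \<le> 1 - y + y\<^sup>2 / 2"
proof -
  have "(\<lambda>t. 1 - t + t\<^sup>2 / 2 - exp (- t)) 0 \<le> (\<lambda>t. 1 - t + t\<^sup>2 / 2 - exp (- t)) y"
  proof (rule DERIV_nonneg_imp_nondecreasing[OF assms])
    fix t :: real
    have "((\<lambda>t. 1 - t + t\<^sup>2 / 2 - exp (- t)) has_real_derivative (- 1 + t + exp (- t))) (at t)"
      by (auto intro!: derivative_eq_intros)
    moreover have "- 1 + t + exp (- t) \<ge> 0" using exp_ge_add_one_self[of "- t"] by linarith
    ultimately show "\<exists>z. ((\<lambda>t. 1 - t + t\<^sup>2 / 2 - exp (- t)) has_real_derivative z) (at t) \<and> z \<ge> 0"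
      by blast
  qed
  then show ?thesis by simp
qed

text \<open>A converse to the linear rate bound, losing only the factor \<open>1 - x / 2\<close>. It
  combines the quadratic bound on \<open>exp\<close> with \<open>1 + t \<le> exp t\<close>; the
  assumption \<alpha> \<le> 1 gives
  \<open>(\<alpha> * x) ^ 2 \<le> \<alpha> * x * x\<close>.\<close>

lemma row_agreement_prob_le_exp:
  assumes a: "\<alpha> \<in> {ln 2..1}" and x: "x \<ge> 0"
  shows "row_agreement_prob \<alpha> x \<le> exp (- (2 * exp (- \<alpha>) * \<alpha> * x * (1 - x / 2)))"
proof -
  have a': "0 < \<alpha>" "\<alpha> \<le> 1" using pos_of_ge_ln2[OF a] a by auto
  have "\<alpha> * x * (\<alpha> * x) \<le> \<alpha> * x * (1 * x)"
    using a' x by (intro mult_left_mono mult_right_mono) auto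
  then have "(\<alpha> * x)\<^sup>2 / 2 \<le> \<alpha> * x * (x / 2)" by (simp add: power2_eq_square)
  then have "\<alpha> * x * (1 - x / 2) \<le> \<alpha> * x - (\<alpha> * x)\<^sup>2 / 2" by (simp add: algebra_simps)
  also have "\<dots> \<le> 1 - exp (- \<alpha> * x)" using exp_minus_le_quadratic[of "\<alpha> * x"] a' x by simp
  finally have "2 * exp (- \<alpha>) * (\<alpha> * x * (1 - x / 2)) \<le> 2 * exp (- \<alpha>) * (1 - exp (- \<alpha> * x))"
    by (intro mult_left_mono) auto
  moreover have "row_agreement_prob \<alpha> x = 1 + - (2 * exp (- \<alpha>) * (1 - exp (- \<alpha> * x)))"
    by (simp add: row_agreement_prob_eq algebra_simps)
  ultimately show ?thesis
    using exp_ge_add_one_self[of "- (2 * exp (- \<alpha>) * (\<alpha> * x * (1 - x / 2)))"]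
    by (simp only: mult.assoc)
qed

section \<open>Bounds on binomial coefficients\<close>

lemma binomial_le_power_real: "real (n choose l) \<le> real n ^ l"
  by (metis binomial_le_pow binomial_eq_0 of_nat_0_le_iff of_nat_le_iff of_nat_power not_le
      of_nat_0 zero_le_power)

text \<open>The quotient \<open>l ^ l / fact l\<close> is a single term of the series for
  \<open>exp l\<close>; this is combined with
  \<open>fact l * (n choose l) \<le> n ^ l\<close>.\<close>

lemma binomial_le_exp_power:
  assumes "l \<ge> 1"
  shows "real (n choose l) \<le> (exp 1 * real n / real l) ^ l"
proof -
  have "real l ^ l / fact l \<le> exp (real l)"
    using sum_le_suminf[OF sums_summable[OF exp_converges[of "real l"]], of "{l}"]
      sums_unique[OF exp_converges[of "real l"]]
    by (simp add: divide_inverse_commute)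
  then have 1: "real l ^ l \<le> exp 1 ^ l * fact l"
    by (simp add: field_simps flip: exp_of_nat_mult)
  have "fact l * (n choose l) \<le> n ^ l"
    by (metis binomial_fact_pow mult.commute)
  then have 2: "fact l * real (n choose l) \<le> real n ^ l"
    by (metis of_nat_fact of_nat_le_iff of_nat_mult of_nat_power)
  have "real (n choose l) * real l ^ l \<le> real (n choose l) * (exp 1 ^ l * fact l)"
    using 1 by (intro mult_left_mono) auto
  also have "\<dots> \<le> exp 1 ^ l * real n ^ l" using 2 by (simp add: mult_ac)
  finally show ?thesis using assms by (simp add: field_simps power_mult_distrib power_divide)
qed

section \<open>Close and distant pairs\<close>

text \<open>The binomials cost at most \<open>(n * k) ^ l = exp (l * P)\<close>. The two linear rate
  bounds show that the power of the agreement probability gains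
  \<open>exp (- l * P * (1 + \<delta> / 2))\<close>.\<close>

lemma confusion_term_small_distance:
  assumes a: "\<alpha> \<in> {ln 2..1}" and k: "k \<ge> 1" and n: "n \<ge> 1" and d: "\<delta> > 0"
    and m: "real m \<ge> (1 + \<delta>) * M2 n k \<alpha>"
    and l: "real l / real k \<le> \<delta> / (1 + \<delta>)"
  shows "real (k choose l) * real (n choose l) * row_agreement_prob \<alpha> (real l / real k) ^ m
    \<le> (real n powr (- \<delta> / 2)) ^ l"
proof -
  define x where "x = real l / real k"
  define c where "c = 2 * exp (- \<alpha>) * \<alpha>"
  define P where "P = ln (real n * real k)"
  have nk: "real n * real k \<ge> 1" using n k by (metis mult_le_mono nat_mult_1 of_nat_1 of_nat_le_iff of_nat_mult)
  have P: "P \<ge> ln (real n)" "P \<ge> 0" using nk n k by (auto simp: P_def ln_mult)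
  define g where "g = - ln (row_agreement_prob \<alpha> (1 / real k))"
  have r: "row_agreement_prob \<alpha> (1 / real k) > 0" "row_agreement_prob \<alpha> (1 / real k) < 1"
    using row_agreement_prob_bounds[OF a, of "1 / real k"] k by auto
  have g: "g > 0" using r by (simp add: g_def)
  have "ln (exp (- (c * (1 / real k)))) \<le> ln (row_agreement_prob \<alpha> (1 / real k))"
    using exp_le_row_agreement_prob[OF a, of "1 / real k"] r by (subst ln_le_cancel_iff) (auto simp: c_def)
  then have gc: "g \<le> c / real k" by (simp add: g_def)
  have "M2 n k \<alpha> = P / g" by (simp add: M2_def g_def P_def row_agreement_prob_def)
  then have "(1 + \<delta>) * P \<le> real m * g" using m mult_right_mono[OF m, of g] g by simp
  also have "\<dots> \<le> real m * (c / real k)" using gc by (intro mult_left_mono) auto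
  finally have mc: "(1 + \<delta>) * P \<le> real m * (c / real k)" .
  have x0: "x \<ge> 0" by (simp add: x_def)
  have xd: "(1 + \<delta>) * x \<le> \<delta>" using l d by (simp add: x_def field_simps)
  have "x \<le> 1" using l d by (simp add: x_def order_trans[OF l])
  \<comment> \<open>The distance restriction gives \<open>(1 + \<delta>) * x \<le> \<delta>\<close>,
    so the loss \<open>1 - x / 2\<close> uses up at most half of the slack \<delta>.\<close>
  have "real l * P * (1 + \<delta> / 2) \<le> real l * P * ((1 + \<delta>) * (1 - x / 2))"
    using P xd by (intro mult_left_mono) (auto simp: right_diff_distrib)
  also have "\<dots> = (real l * (1 - x / 2)) * ((1 + \<delta>) * P)" by (simp add: algebra_simps)
  also have "\<dots> \<le> (real l * (1 - x / 2)) * (real m * (c / real k))"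
    using mc \<open>x \<le> 1\<close> by (intro mult_left_mono) auto
  also have "\<dots> = real m * (c * x * (1 - x / 2))" by (simp add: x_def)
  finally have key: "real l * P * (1 + \<delta> / 2) \<le> real m * (c * x * (1 - x / 2))" .
  have r0: "row_agreement_prob \<alpha> x \<ge> 0"
    using two_exp_minus_le_1[OF a] by (simp add: row_agreement_prob_eq)
  then have "row_agreement_prob \<alpha> x ^ m \<le> exp (- (c * x * (1 - x / 2))) ^ m"
    using row_agreement_prob_le_exp[OF a x0] by (intro power_mono) (auto simp: c_def)
  also have "\<dots> = exp (- (real m * (c * x * (1 - x / 2))))" by (simp flip: exp_of_nat_mult)
  also have "\<dots> \<le> exp (- (real l * P * (1 + \<delta> / 2)))" using key by simp
  finally have p: "row_agreement_prob \<alpha> x ^ m \<le> exp (- (real l * P * (1 + \<delta> / 2)))" .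
  have "real (k choose l) * real (n choose l) \<le> real k ^ l * real n ^ l"
    by (intro mult_mono binomial_le_power_real) auto
  also have "\<dots> = exp P ^ l" using nk by (simp add: P_def power_mult_distrib mult.commute)
  also have "\<dots> = exp (real l * P)" by (simp flip: exp_of_nat_mult)
  finally have "real (k choose l) * real (n choose l) * row_agreement_prob \<alpha> x ^ m
      \<le> exp (real l * P) * exp (- (real l * P * (1 + \<delta> / 2)))"
    using p r0 by (intro mult_mono) auto
  also have "\<dots> = exp (- (real l * (P * (\<delta> / 2))))" by (simp add: algebra_simps flip: exp_add)
  also have "\<dots> \<le> exp (- (real l * (ln (real n) * (\<delta> / 2))))"
    using P d by (auto intro!: mult_left_mono mult_right_mono)
  also have "\<dots> = (real n powr (- \<delta> / 2)) ^ l"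
    using n by (simp add: powr_def mult_ac flip: exp_of_nat_mult)
  finally show ?thesis by (simp add: x_def)
qed

text \<open>The power bound and the hypothesis on \<open>M1\<close> give a factor
  \<open>(k / n) powr ((1 + \<delta>) * l)\<close>. The binomials cost \<open>(n / k) ^ l\<close> up
  to a constant to the power \<open>l\<close>, which leaves the exponent \<delta>.\<close>

lemma confusion_term_large_distance:
  assumes a: "\<alpha> \<in> {ln 2..1}" and k: "k \<ge> 1" and n: "n \<ge> k"
    and m: "real m \<ge> (1 + \<delta>) * M1 n k \<alpha>" and eta: "\<eta> > 0"
    and l: "1 \<le> l" "l \<le> k" "real l / real k \<ge> \<eta>"
  shows "real (k choose l) * real (n choose l) * row_agreement_prob \<alpha> (real l / real k) ^ m
    \<le> ((exp 1 / \<eta>)\<^sup>2 * (real k / real n) powr \<delta>) ^ l"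
proof -
  define x where "x = real l / real k"
  define Q where "Q = ln (real n / real k)"
  define F where "F = row_agreement_prob \<alpha> 1"
  have F: "F > 0" "F < 1" using row_agreement_prob_bounds[OF a, of 1] by (auto simp: F_def)
  have x: "0 \<le> x" "x \<le> 1" using l k by (auto simp: x_def)
  have "M1 n k \<alpha> = real k * Q / (- ln F)"
    by (simp add: M1_def F_def Q_def row_agreement_prob_def mult.commute)
  then have "(1 + \<delta>) * (real k * Q) \<le> real m * (- ln F)"
    using mult_right_mono[OF m, of "- ln F"] F by simp
  then have "(1 + \<delta>) * (real k * Q) * x \<le> real m * (- ln F) * x"
    using x by (intro mult_right_mono) auto
  then have key: "(1 + \<delta>) * (real l * Q) \<le> - (real m * (x * ln F))"
    using k by (simp add: x_def mult_ac)
  have r0: "row_agreement_prob \<alpha> x \<ge> 0"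
    using two_exp_minus_le_1[OF a] by (simp add: row_agreement_prob_eq)
  then have "row_agreement_prob \<alpha> x ^ m \<le> (F powr x) ^ m"
    using row_agreement_prob_le_powr[OF a x] by (intro power_mono) (auto simp: F_def)
  also have "\<dots> = exp (real m * (x * ln F))" using F by (simp add: powr_def flip: exp_of_nat_mult)
  also have "\<dots> \<le> exp (- ((1 + \<delta>) * (real l * Q)))" using key by simp
  finally have p: "row_agreement_prob \<alpha> x ^ m \<le> exp (- ((1 + \<delta>) * (real l * Q)))" .
  \<comment> \<open>This is where the distance being proportional to \<open>k\<close> enters: it
    makes the factor \<open>k / l\<close> in both binomial bounds a constant.\<close>
  have kl: "real k / real l \<le> 1 / \<eta>" using l k eta by (simp add: field_simps)
  have 1: "real (k choose l) \<le> (exp 1 / \<eta>) ^ l"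
  proof (rule order_trans[OF binomial_le_exp_power[OF l(1)]], rule power_mono)
    show "exp 1 * real k / real l \<le> exp 1 / \<eta>"
      using mult_left_mono[OF kl, of "exp 1"] by simp
  qed simp
  have 2: "real (n choose l) \<le> (exp 1 / \<eta> * (real n / real k)) ^ l"
  proof (rule order_trans[OF binomial_le_exp_power[OF l(1)]], rule power_mono)
    have "exp 1 * real n / real l = exp 1 * (real n / real k) * (real k / real l)" using k by simp
    also have "\<dots> \<le> exp 1 * (real n / real k) * (1 / \<eta>)" by (intro mult_left_mono kl) simp
    finally show "exp 1 * real n / real l \<le> exp 1 / \<eta> * (real n / real k)"
      by (simp add: mult.commute)
  qed simp
  have "real (k choose l) * real (n choose l) * row_agreement_prob \<alpha> x ^ m
      \<le> (exp 1 / \<eta>) ^ l * (exp 1 / \<eta> * (real n / real k)) ^ l * exp (- ((1 + \<delta>) * (real l * Q)))"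
    using 1 2 p r0 eta by (intro mult_mono) auto
  also have "(exp 1 / \<eta> * (real n / real k)) ^ l = (exp 1 / \<eta>) ^ l * exp (real l * Q)"
    using k n by (simp add: Q_def power_mult_distrib power_divide exp_of_nat_mult)
  also have "(exp 1 / \<eta>) ^ l * ((exp 1 / \<eta>) ^ l * exp (real l * Q)) * exp (- ((1 + \<delta>) * (real l * Q)))
      = ((exp 1 / \<eta>)\<^sup>2) ^ l * exp (real l * (- \<delta> * Q))"
  proof -
    have "exp (real l * Q) * exp (- ((1 + \<delta>) * (real l * Q))) = exp (real l * (- \<delta> * Q))"
      by (simp add: algebra_simps flip: exp_add)
    moreover have "((exp 1 / \<eta>)\<^sup>2) ^ l = (exp 1 / \<eta>) ^ l * (exp 1 / \<eta>) ^ l"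
      by (simp only: power2_eq_square power_mult_distrib)
    ultimately show ?thesis by (simp only: mult.assoc)
  qed
  also have "exp (real l * (- \<delta> * Q)) = ((real k / real n) powr \<delta>) ^ l"
  proof -
    have "ln (real k / real n) = - Q" using k n by (simp add: Q_def ln_div)
    then show ?thesis using k n by (simp add: powr_def flip: exp_of_nat_mult)
  qed
  finally show ?thesis by (simp add: x_def power_mult_distrib)
qed

section \<open>Summation over all distances\<close>

lemma sum_power_le_double:
  fixes r :: real
  assumes "0 \<le> r" "r \<le> 1/2"
  shows "(\<Sum>l=1..k. r ^ l) \<le> 2 * r"
proof -
  \<comment> \<open>Subtracting \<open>2 * r ^ Suc k\<close> strengthens the bound enough for
    induction.\<close>
  have "(\<Sum>l=1..k. r ^ l) \<le> 2 * r - 2 * r ^ Suc k"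
  proof (induction k)
    case (Suc k)
    have "r * r ^ Suc k \<le> 1/2 * r ^ Suc k" using assms by (intro mult_right_mono) auto
    then show ?case using Suc by simp
  qed simp
  also have "\<dots> \<le> 2 * r" using assms by simp
  finally show ?thesis .
qed

lemma expected_confusion_le:
  assumes a: "\<alpha> \<in> {ln 2..1}" and k: "k \<ge> 1" and n: "n \<ge> k" and d: "\<delta> > 0"
    and m: "real m \<ge> (1 + \<delta>) * max (M1 n k \<alpha>) (M2 n k \<alpha>)"
    and r1: "r1 = real n powr (- \<delta> / 2)" "r1 \<le> 1/2"
    and r2: "r2 = (exp 1 * (1 + \<delta>) / \<delta>)\<^sup>2 * (real k / real n) powr \<delta>" "r2 \<le> 1/2"
  shows "expected_confusion m n k \<alpha> \<le> 2 * r1 + 2 * r2"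
proof -
  have pos: "r1 \<ge> 0" "r2 \<ge> 0" using r1 r2 by auto
  have m1: "real m \<ge> (1 + \<delta>) * M1 n k \<alpha>"
    using d by (intro order_trans[OF mult_left_mono m]) auto
  have m2: "real m \<ge> (1 + \<delta>) * M2 n k \<alpha>"
    using d by (intro order_trans[OF mult_left_mono m]) auto
  have "expected_confusion m n k \<alpha> \<le> (\<Sum>l=1..k. r1 ^ l + r2 ^ l)"
    unfolding expected_confusion_def
  proof (rule sum_mono)
    fix l assume l: "l \<in> {1..k}"
    let ?t = "real (k choose l) * real (n choose l) * row_agreement_prob \<alpha> (real l / real k) ^ m"
    show "?t \<le> r1 ^ l + r2 ^ l"
    proof (cases "real l / real k \<le> \<delta> / (1 + \<delta>)")
      case True
      have "?t \<le> r1 ^ l"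
        using confusion_term_small_distance[OF a k _ d m2 True] n k r1 by simp
      then show ?thesis using pos by (simp add: add_increasing2)
    next
      case False
      have "?t \<le> ((exp 1 / (\<delta> / (1 + \<delta>)))\<^sup>2 * (real k / real n) powr \<delta>) ^ l"
        using False l d by (intro confusion_term_large_distance[OF a k n m1]) auto
      also have "\<dots> = r2 ^ l" using r2 by simp
      finally show ?thesis using pos by (simp add: add_increasing)
    qed
  qed
  also have "\<dots> = (\<Sum>l=1..k. r1 ^ l) + (\<Sum>l=1..k. r2 ^ l)" by (rule sum.distrib)
  also have "\<dots> \<le> 2 * r1 + 2 * r2"
    using pos r1(2) r2(2) by (intro add_mono sum_power_le_double)
  finally show ?thesis .
qed

section \<open>Order of growth of the number of rows\<close>

text \<open>Covers the finitely many \<open>n\<close> below the asymptotic threshold: in the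
  identity matrix the union of supports over \<open>K\<close> is \<open>K\<close> itself.\<close>

lemma identity_almost_separable:
  assumes "\<epsilon> \<ge> 0"
  shows "\<exists>A\<in>binary_mats n n. almost_separable \<epsilon> k A"
proof
  let ?A = "mat_of_row_sets n n (\<lambda>i. {i})"
  have dim: "dim_col ?A = n" by (simp add: mat_of_row_sets_def)
  have "union_supp ?A K = K" if "K \<subseteq> {..<n}" for K
    using union_supp_mat_of_row_sets[OF that, of n "\<lambda>i. {i}"] that by auto
  then have "{K. K \<subseteq> {..<n} \<and> card K = k \<and>
       (\<exists>L. L \<subseteq> {..<n} \<and> card L = k \<and> L \<noteq> K \<and> union_supp ?A L = union_supp ?A K)} = {}"
    by auto
  then show "almost_separable \<epsilon> k ?A"
    unfolding almost_separable_def dim using assms by (simp only:) simp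
qed (rule mat_of_row_sets_binary)

text \<open>The trial value \<alpha> = \<open>ln 2\<close> makes the agreement probability exactly
  \<open>2 powr (- x)\<close>, so the denominators of \<open>M1\<close> and \<open>M2\<close> are
  \<open>ln 2\<close> and \<open>ln 2 / k\<close>. Both numerators are then controlled by
  \<open>0 \<le> ln k \<le> ln n\<close>.\<close>

lemma M_le:
  assumes k: "k \<ge> 1" and n: "n \<ge> k"
  shows "M n k \<le> 2 / ln 2 * (real k * ln (real n))"
proof -
  have "ln 2 \<le> (1::real)" using ln_le_minus_one[of "2::real"] by simp
  then have mem: "ln 2 \<in> {ln 2..1::real}" by simp
  have e: "exp (- ln 2) = (1/2::real)" by (simp add: exp_minus)
  have "M n k \<le> max (M1 n k (ln 2)) (M2 n k (ln 2))"
    using M_attained[OF k, of n] mem by auto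
  moreover have "1 - 2 * exp (- ln 2) + 2 * exp (- 2 * ln 2) = (1 / 2 :: real)"
  proof -
    have "exp (- 2 * ln 2) = exp (- ln 2) * exp (- ln 2 :: real)" by (simp flip: exp_add)
    then show ?thesis using e by simp
  qed
  then have "M1 n k (ln 2) = real k * ln (real n / real k) / ln 2"
    unfolding M1_def by (simp only:) (simp add: ln_div)
  moreover have "1 - 2 * exp (- ln 2) + 2 * exp (- ln 2 * (1 + 1 / real k)) = exp (- (ln 2 / real k))"
  proof -
    have "exp (- ln 2 * (1 + 1 / real k)) = exp (- ln 2) * exp (- (ln 2 / real k))"
      by (simp add: algebra_simps flip: exp_add)
    then show ?thesis using e by simp
  qed
  then have "M2 n k (ln 2) = real k * ln (real n * real k) / ln 2"
    unfolding M2_def by (simp only: ln_exp) simp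
  moreover have "real k * ln (real n / real k) \<le> real k * (2 * ln (real n))"
    "real k * ln (real n * real k) \<le> real k * (2 * ln (real n))"
  proof -
    have "0 \<le> ln (real k)" "ln (real k) \<le> ln (real n)" using k n by auto
    moreover have "ln (real n / real k) = ln (real n) - ln (real k)"
      "ln (real n * real k) = ln (real n) + ln (real k)"
      using k n by (auto simp: ln_div ln_mult)
    ultimately have "ln (real n / real k) \<le> 2 * ln (real n)" "ln (real n * real k) \<le> 2 * ln (real n)"
      by linarith+
    then show "real k * ln (real n / real k) \<le> real k * (2 * ln (real n))"
      "real k * ln (real n * real k) \<le> real k * (2 * ln (real n))"
      by (auto intro!: mult_left_mono)
  qed
  moreover have "y / ln 2 \<le> 2 / ln 2 * (real k * ln (real n))"
    if "y \<le> real k * (2 * ln (real n))" for y :: real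
    using divide_right_mono[OF that, of "ln 2"] by (simp add: mult_ac)
  ultimately show ?thesis by (metis max_def order_trans)
qed

theorem theorem2:
  fixes k :: "nat \<Rightarrow> nat"
  assumes "\<And>n. n \<ge> 1 \<Longrightarrow> k n \<ge> 1"
    and "(\<lambda>n. real (k n)) \<in> o(\<lambda>n. real n)"
  shows "(\<forall>\<epsilon>>0. \<exists>m :: nat \<Rightarrow> nat.
            (\<lambda>n. real (m n)) \<in> O(\<lambda>n. real (k n) * ln (real n)) \<and>
            (\<forall>n\<ge>1. \<exists>A \<in> binary_mats (m n) n. almost_separable \<epsilon> (k n) A)) \<and>
         (\<forall>\<epsilon>>0. \<forall>\<delta>>0. \<forall>\<^sub>F n in sequentially.
            \<forall>m :: nat. real m > (1 + \<delta>) * M n (k n) \<longrightarrow>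
              (\<exists>A \<in> binary_mats m n. almost_separable \<epsilon> (k n) A))"
proof -
  have ratio: "(\<lambda>n. real (k n) / real n) \<longlonglongrightarrow> 0"
    using assms(2) by (rule smalloD_tendsto)
  have le: "\<forall>\<^sub>F n in sequentially. k n \<le> n"
    using order_tendstoD(2)[OF ratio, of 1, simplified] eventually_gt_at_top[of 0]
    by eventually_elim (auto simp: field_simps)
  \<comment> \<open>This is the second claim; the first follows from its instance \<delta> =
    1.\<close>
  have main: "\<forall>\<^sub>F n in sequentially. \<forall>m :: nat. real m > (1 + \<delta>) * M n (k n) \<longrightarrow>
      (\<exists>A \<in> binary_mats m n. almost_separable \<epsilon> (k n) A)" if e: "\<epsilon> > 0" and d: "\<delta> > 0" for \<epsilon> \<delta> :: real
  proof -
    define r1 where "r1 n = real n powr (- \<delta> / 2)" for n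
    define r2 where "r2 n = (exp 1 * (1 + \<delta>) / \<delta>)\<^sup>2 * (real (k n) / real n) powr \<delta>" for n
    have "r1 \<longlonglongrightarrow> 0"
      unfolding r1_def using d by (intro tendsto_neg_powr filterlim_real_sequentially) auto
    \<comment> \<open>The bound 1/2 is for the geometric series, and \<epsilon>/4 makes
      \<open>2 * r1 n + 2 * r2 n\<close> at most \<epsilon>.\<close>
    then have e1: "\<forall>\<^sub>F n in sequentially. r1 n < min (1/2) (\<epsilon> / 4)"
      using e by (intro order_tendstoD(2)) auto
    have "(\<lambda>n. (real (k n) / real n) powr \<delta>) \<longlonglongrightarrow> 0 powr \<delta>"
      using d ratio by (intro tendsto_powr') auto
    then have "r2 \<longlonglongrightarrow> 0"
      unfolding r2_def by (intro tendsto_mult_right_zero) simp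
    then have e2: "\<forall>\<^sub>F n in sequentially. r2 n < min (1/2) (\<epsilon> / 4)"
      using e by (intro order_tendstoD(2)) auto
    from le e1 e2 eventually_ge_at_top[of 1] show ?thesis
    proof eventually_elim
      case (elim n)
      have k: "k n \<ge> 1" using assms(1) elim by simp
      show ?case
      proof (intro allI impI)
        fix m :: nat assume m: "real m > (1 + \<delta>) * M n (k n)"
        obtain \<alpha> where \<alpha>: "\<alpha> \<in> {ln 2..1}" "M n (k n) = max (M1 n (k n) \<alpha>) (M2 n (k n) \<alpha>)"
          using M_attained[OF k, of n] by blast
        have "expected_confusion m n (k n) \<alpha> \<le> 2 * r1 n + 2 * r2 n"
          using elim m \<alpha> by (intro expected_confusion_le[OF \<alpha>(1) k _ d _ r1_def _ r2_def]) auto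
        also have "\<dots> \<le> \<epsilon>" using elim by simp
        finally show "\<exists>A \<in> binary_mats m n. almost_separable \<epsilon> (k n) A"
          by (rule exists_mat_few_confused[OF k \<alpha>(1)])
      qed
    qed
  qed
  moreover have "\<exists>m :: nat \<Rightarrow> nat.
            (\<lambda>n. real (m n)) \<in> O(\<lambda>n. real (k n) * ln (real n)) \<and>
            (\<forall>n\<ge>1. \<exists>A \<in> binary_mats (m n) n. almost_separable \<epsilon> (k n) A)"
    if e: "\<epsilon> > 0" for \<epsilon> :: real
  proof -
    obtain N where N: "\<And>n m :: nat. n \<ge> N \<Longrightarrow> real m > (1 + 1) * M n (k n) \<Longrightarrow>
        \<exists>A \<in> binary_mats m n. almost_separable \<epsilon> (k n) A"
      using main[OF e, of 1] by (auto simp: eventually_sequentially)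
    \<comment> \<open>Adding 1 to the floor gives the strict inequality that \<open>N\<close>
      demands; if the floor is negative, \<open>nat\<close> yields 0 and the inequality still
      holds.\<close>
    define m where "m n = (if n < N then n else nat \<lfloor>2 * M n (k n)\<rfloor> + 1)" for n
    have "\<exists>A \<in> binary_mats (m n) n. almost_separable \<epsilon> (k n) A" for n
    proof (cases "n < N")
      case True
      then show ?thesis using identity_almost_separable[of \<epsilon> n "k n"] e by (simp add: m_def)
    next
      case False
      then have "real (m n) > (1 + 1) * M n (k n)" by (simp add: m_def) linarith
      then show ?thesis using N[of n "m n"] False by simp
    qed
    moreover have "(\<lambda>n. real (m n)) \<in> O(\<lambda>n. real (k n) * ln (real n))"
    proof (rule bigoI)
      show "\<forall>\<^sub>F n in sequentially. norm (real (m n)) \<le> (4 / ln 2 + 1) * norm (real (k n) * ln (real n))"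
        \<comment> \<open>From \<open>n \<ge> 3\<close> follows \<open>ln n \<ge> 1\<close>, so
          \<open>k n * ln n \<ge> 1\<close> absorbs the added 1. This explains the constant: twice
          that of \<open>M_le\<close>, plus 1.\<close>
        using le eventually_ge_at_top[of N] eventually_ge_at_top[of 3]
      proof eventually_elim
        case (elim n)
        have k: "k n \<ge> 1" using assms(1) elim by simp
        have "exp 1 \<le> real n" using exp_le elim by linarith
        then have "1 \<le> ln (real n)" using elim by (subst ln_ge_iff) auto
        with k have kl: "1 \<le> real (k n) * ln (real n)"
          using mult_mono[of 1 "real (k n)" 1 "ln (real n)"] by simp
        have M: "2 * M n (k n) \<le> 4 / ln 2 * (real (k n) * ln (real n))"
          using M_le[OF k elim(1)] by simp
        have "real (m n) \<le> max 0 (2 * M n (k n)) + 1"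
          using elim by (simp add: m_def) linarith
        also have "\<dots> \<le> (4 / ln 2 + 1) * (real (k n) * ln (real n))"
        proof -
          have "4 / ln 2 * (real (k n) * ln (real n)) \<ge> 0" using kl
            by (intro mult_nonneg_nonneg[of "4 / ln 2"]) (simp, linarith)
          then show ?thesis using M kl by (simp only: distrib_right)
        qed
        finally show ?case using kl by simp
      qed
    qed
    ultimately show ?thesis by blast
  qed
  ultimately show ?thesis by blast
qed

end
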